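(* Let $D\subseteq\mathbb{C}$ be a domain, let $a,b,c\in\mathbb{C}_\infty$ be three distinct values, and let $\mathcal{F}$ be a family of meromorphic functions on $D$ that omits $a,b,c$, i.e. $f(z)\notin\{a,b,c\}$ for all $f\in\mathcal{F}$ and $z\in D$. Then $\mathcal{F}$ is normal on $D$.
   Context: $\mathbb{C}_\infty$ is the extended complex plane (Riemann sphere), and meromorphic functions on $D$ are regarded as continuous maps $D\to\mathbb{C}_\infty$. A family $\mathcal{F}$ of meromorphic functions on $D$ is normal on $D$ if every sequence in $\mathcal{F}$ contains a subsequence that converges locally uniformly on $D$ with respect to the spherical metric on $\mathbb{C}_\infty$. *)

theory Defs
  imports "HOL-Complex_Analysis.Complex_Analysis"
begin

datatype ecomplex = Finite complex | Infinity

(* Stereographic projection onto the unit sphere of the Euclidean 3-space complex \<times> real;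
   the point at infinity is the north pole. *)
fun stereo :: "ecomplex \<Rightarrow> complex \<times> real" where
  "stereo (Finite z) =
     ((2 / ((cmod z)\<^sup>2 + 1)) *\<^sub>R z, ((cmod z)\<^sup>2 - 1) / ((cmod z)\<^sup>2 + 1))"
| "stereo Infinity = (0, 1)"

lemma norm_stereo [simp]: "norm (stereo p) = 1"
proof (cases p)
  case (Finite z)
  define s where "s = (cmod z)\<^sup>2"
  have s: "s + 1 > 0" by (simp add: s_def add_nonneg_pos)
  have "(norm (stereo p))\<^sup>2 = (2 / (s + 1))\<^sup>2 * s + ((s - 1) / (s + 1))\<^sup>2"
    by (simp add: Finite norm_prod_def s_def power_mult_distrib power_divide)
  also have "\<dots> = (4 * s + (s - 1)\<^sup>2) / (s + 1)\<^sup>2"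
    by (simp add: power_divide add_divide_distrib)
  also have "4 * s + (s - 1)\<^sup>2 = (s + 1)\<^sup>2" by (simp add: power2_eq_square algebra_simps)
  finally have "(norm (stereo p))\<^sup>2 = 1" using s by simp
  thus ?thesis by (metis norm_ge_zero power2_eq_1_iff zero_le_one abs_of_nonneg abs_1 abs_minus)
qed (simp add: norm_prod_def)

lemma stereo_inject: "stereo p = stereo q \<longleftrightarrow> p = q"
proof
  have pos: "(cmod z)\<^sup>2 + 1 > 0" for z by (simp add: add_nonneg_pos)
  have snd: "snd (stereo (Finite z)) = 1 - 2 / ((cmod z)\<^sup>2 + 1)" for z
    using pos[of z] by (simp add: field_simps)
  assume eq: "stereo p = stereo q"
  show "p = q"
  proof (cases p; cases q)
    fix z w assume pq: "p = Finite z" "q = Finite w"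
    have "2 / ((cmod z)\<^sup>2 + 1) = 2 / ((cmod w)\<^sup>2 + 1)"
      using arg_cong[OF eq, of snd] unfolding pq snd by linarith
    moreover have "2 / ((cmod z)\<^sup>2 + 1) \<noteq> 0" using pos[of z] by simp
    ultimately show ?thesis using arg_cong[OF eq, of fst] by (simp add: pq)
  next
    fix z assume "p = Finite z" "q = Infinity"
    thus ?thesis using arg_cong[OF eq, of snd] snd[of z] pos[of z] by simp
  next
    fix z assume "p = Infinity" "q = Finite z"
    thus ?thesis using arg_cong[OF eq, of snd] snd[of z] pos[of z] by simp
  qed simp
qed simp

lemma abs_inner_unit_le:
  fixes u v :: "'a::real_inner"
  assumes "norm u = 1" "norm v = 1"
  shows "\<bar>u \<bullet> v\<bar> \<le> 1"
  using Cauchy_Schwarz_ineq2[of u v] assms by simp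

lemma arccos_inner_triangle:
  fixes u v w :: "'a::real_inner"
  assumes "norm u = 1" "norm v = 1" "norm w = 1"
  shows "arccos (u \<bullet> w) \<le> arccos (u \<bullet> v) + arccos (v \<bullet> w)"
proof -
  define a b where "a = u \<bullet> v" and "b = v \<bullet> w"
  have ab: "\<bar>a\<bar> \<le> 1" "\<bar>b\<bar> \<le> 1" "\<bar>u \<bullet> w\<bar> \<le> 1"
    unfolding a_def b_def by (intro abs_inner_unit_le assms)+
  have uu: "u \<bullet> u = 1" "v \<bullet> v = 1" "w \<bullet> w = 1" using assms by (simp_all add: norm_eq_1)
  have "norm (u - a *\<^sub>R v) = sqrt (1 - a\<^sup>2)" "norm (w - b *\<^sub>R v) = sqrt (1 - b\<^sup>2)"
    by (simp_all add: norm_eq_sqrt_inner inner_diff inner_commute uu a_def b_def power2_eq_square)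
  hence "- (sqrt (1 - a\<^sup>2) * sqrt (1 - b\<^sup>2)) \<le> (u - a *\<^sub>R v) \<bullet> (w - b *\<^sub>R v)"
    using Cauchy_Schwarz_ineq2[of "u - a *\<^sub>R v" "w - b *\<^sub>R v"] by simp
  also have "\<dots> = u \<bullet> w - a * b"
    by (simp add: inner_diff inner_commute uu a_def b_def)
  finally have *: "cos (arccos a + arccos b) \<le> u \<bullet> w"
    using ab by (simp add: cos_add sin_arccos_abs)
  show ?thesis
  proof (cases "arccos a + arccos b \<le> pi")
    case True
    have "arccos (u \<bullet> w) \<le> arccos (cos (arccos a + arccos b))"
      using ab * by (intro arccos_le_arccos) auto
    also have "\<dots> = arccos a + arccos b"
      using True ab arccos_lbound[of a] arccos_lbound[of b] by (intro arccos_cos) auto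
    finally show ?thesis by (simp add: a_def b_def)
  next
    case False
    thus ?thesis using arccos_ubound[of "u \<bullet> w"] ab(3) by (auto simp: a_def b_def abs_le_iff)
  qed
qed

(* The spherical metric: great-circle distance between the stereographic images.
   Its Riemannian element is 2|dz| / (1 + |z|^2). *)
instantiation ecomplex :: metric_space
begin

definition dist_ecomplex :: "ecomplex \<Rightarrow> ecomplex \<Rightarrow> real" where
  "dist_ecomplex p q = arccos (stereo p \<bullet> stereo q)"

definition uniformity_ecomplex :: "(ecomplex \<times> ecomplex) filter" where
  "uniformity_ecomplex = (INF e\<in>{0<..}. principal {(x, y). dist x y < e})"

definition open_ecomplex :: "ecomplex set \<Rightarrow> bool" where
  "open_ecomplex U \<longleftrightarrow> (\<forall>x\<in>U. eventually (\<lambda>(x', y). x' = x \<longrightarrow> y \<in> U) uniformity)"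

instance
proof
  fix p q r :: ecomplex
  have bd: "\<bar>stereo p \<bullet> stereo q\<bar> \<le> 1" by (rule abs_inner_unit_le) simp_all
  show "dist p q = 0 \<longleftrightarrow> p = q"
  proof
    assume "dist p q = 0"
    hence "stereo p \<bullet> stereo q = 1"
      using cos_arccos_abs[OF bd] by (simp add: dist_ecomplex_def)
    hence "(norm (stereo p - stereo q))\<^sup>2 = 0"
      using norm_eq_1[of "stereo p"] norm_eq_1[of "stereo q"]
      by (simp add: power2_norm_eq_inner inner_diff inner_commute)
    thus "p = q" by (simp add: stereo_inject)
  next
    assume "p = q"
    thus "dist p q = 0" using norm_eq_1[of "stereo q"] by (simp add: dist_ecomplex_def)
  qed
  show "dist p q \<le> dist p r + dist q r"
    unfolding dist_ecomplex_def
    using arccos_inner_triangle[of "stereo p" "stereo r" "stereo q"] by (simp add: inner_commute)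
qed (simp_all add: uniformity_ecomplex_def open_ecomplex_def)

end

(* A meromorphic function regarded as a map into the sphere. A nicely meromorphic g has no
   removable singularities and takes the dummy value 0 at its poles, where f is Infinity.
   The constant map Infinity is not meromorphic. Values of f outside D are irrelevant. *)
definition sphere_meromorphic_on :: "(complex \<Rightarrow> ecomplex) \<Rightarrow> complex set \<Rightarrow> bool" where
  "sphere_meromorphic_on f D \<longleftrightarrow>
     (\<exists>g. g nicely_meromorphic_on D \<and>
          (\<forall>z\<in>D. f z = (if is_pole g z then Infinity else Finite (g z))))"

definition locally_uniform_limit_on ::
    "'a::topological_space set \<Rightarrow> (nat \<Rightarrow> 'a \<Rightarrow> 'b::metric_space) \<Rightarrow> ('a \<Rightarrow> 'b) \<Rightarrow> bool" where
  "locally_uniform_limit_on D s h \<longleftrightarrow>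
     (\<forall>z\<in>D. \<exists>U. openin (top_of_set D) U \<and> z \<in> U \<and> uniform_limit U s h sequentially)"

definition normal_family_on :: "(complex \<Rightarrow> ecomplex) set \<Rightarrow> complex set \<Rightarrow> bool" where
  "normal_family_on F D \<longleftrightarrow>
     (\<forall>s :: nat \<Rightarrow> complex \<Rightarrow> ecomplex. range s \<subseteq> F \<longrightarrow>
        (\<exists>r h. strict_mono r \<and> locally_uniform_limit_on D (s \<circ> r) h))"

lemma tendsto_ecomplex_iff:
  "(f \<longlongrightarrow> p) F \<longleftrightarrow> ((\<lambda>x. stereo (f x)) \<longlongrightarrow> stereo p) F"
proof
  have bd: "\<bar>stereo x \<bullet> stereo y\<bar> \<le> 1" for x y by (rule abs_inner_unit_le) simp_all
  have sq: "(dist (stereo x) (stereo y))\<^sup>2 = 2 - 2 * cos (dist x y)" for x y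
    using norm_eq_1[of "stereo x"] norm_eq_1[of "stereo y"] cos_arccos_abs[OF bd[of x y]]
    by (simp add: dist_ecomplex_def dist_norm power2_norm_eq_inner inner_diff inner_commute)
  {
    assume "(f \<longlongrightarrow> p) F"
    hence "((\<lambda>x. dist (f x) p) \<longlongrightarrow> 0) F" by (simp add: tendsto_dist_iff[symmetric])
    hence "((\<lambda>x. sqrt (2 - 2 * cos (dist (f x) p))) \<longlongrightarrow> sqrt (2 - 2 * cos 0)) F"
      by (intro tendsto_real_sqrt tendsto_diff tendsto_mult tendsto_const isCont_tendsto_compose[OF isCont_cos])
    hence "((\<lambda>x. dist (stereo (f x)) (stereo p)) \<longlongrightarrow> 0) F"
      by (simp add: sq[symmetric])
    thus "((\<lambda>x. stereo (f x)) \<longlongrightarrow> stereo p) F" by (simp add: tendsto_dist_iff[symmetric])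
  next
    assume "((\<lambda>x. stereo (f x)) \<longlongrightarrow> stereo p) F"
    hence "((\<lambda>x. stereo (f x) \<bullet> stereo p) \<longlongrightarrow> stereo p \<bullet> stereo p) F"
      by (intro tendsto_intros)
    hence lim: "((\<lambda>x. stereo (f x) \<bullet> stereo p) \<longlongrightarrow> 1) F"
      using norm_eq_1[of "stereo p"] by simp
    have "((\<lambda>x. arccos (stereo (f x) \<bullet> stereo p)) \<longlongrightarrow> arccos 1) F"
      using continuous_on_tendsto_compose[OF continuous_on_arccos' lim] bd
      by (auto simp: abs_le_iff minus_le_iff)
    hence "((\<lambda>x. dist (f x) p) \<longlongrightarrow> 0) F" by (simp add: dist_ecomplex_def)
    thus "(f \<longlongrightarrow> p) F" by (simp add: tendsto_dist_iff[symmetric])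
  }
qed

lemma tendsto_Finite:
  assumes "(f \<longlongrightarrow> z) F"
  shows "((\<lambda>x. Finite (f x)) \<longlongrightarrow> Finite z) F"
proof -
  have "(cmod z)\<^sup>2 + 1 \<noteq> 0" by (metis add_nonneg_pos less_irrefl zero_le_power2 zero_less_one)
  thus ?thesis unfolding tendsto_ecomplex_iff stereo.simps
    by (intro tendsto_intros assms)
qed

lemma tendsto_Infinity:
  assumes "filterlim f at_infinity F"
  shows "((\<lambda>x. Finite (f x)) \<longlongrightarrow> Infinity) F"
proof -
  have n: "filterlim (\<lambda>x. cmod (f x)) at_top F"
    using assms by (rule filterlim_compose[OF filterlim_norm_at_top])
  have "((\<lambda>t::real. 2 * t / (t\<^sup>2 + 1)) \<longlongrightarrow> 0) at_top"
       "((\<lambda>t::real. (t\<^sup>2 - 1) / (t\<^sup>2 + 1)) \<longlongrightarrow> 1) at_top"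
    by real_asymp+
  hence 1: "((\<lambda>x. 2 * cmod (f x) / ((cmod (f x))\<^sup>2 + 1)) \<longlongrightarrow> 0) F"
    and 2: "((\<lambda>x. ((cmod (f x))\<^sup>2 - 1) / ((cmod (f x))\<^sup>2 + 1)) \<longlongrightarrow> 1) F"
    using n by (auto dest: filterlim_compose)
  have "norm ((2 / ((cmod z)\<^sup>2 + 1)) *\<^sub>R z) = 2 * cmod z / ((cmod z)\<^sup>2 + 1)" for z
    by simp
  hence "((\<lambda>x. (2 / ((cmod (f x))\<^sup>2 + 1)) *\<^sub>R f x) \<longlongrightarrow> 0) F"
    using 1 by (subst tendsto_norm_zero_iff[symmetric]) (simp del: norm_scaleR)
  thus ?thesis unfolding tendsto_ecomplex_iff stereo.simps by (intro tendsto_Pair 2)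
qed

lemma sphere_meromorphic_on_imp_continuous_on:
  assumes "sphere_meromorphic_on f D" "open D"
  shows "continuous_on D f"
proof -
  obtain g where g: "g nicely_meromorphic_on D"
    and f: "\<And>z. z \<in> D \<Longrightarrow> f z = (if is_pole g z then Infinity else Finite (g z))"
    using assms(1) unfolding sphere_meromorphic_on_def by blast
  have "f \<midarrow>z\<rightarrow> f z" if z: "z \<in> D" for z
  proof -
    have "g meromorphic_on {z}"
      using g z by (auto simp: nicely_meromorphic_on_def intro: meromorphic_on_subset)
    hence "eventually (\<lambda>w. \<not> is_pole g w) (at z)"
      using eventually_not_pole meromorphic_at_iff by blast
    moreover have "eventually (\<lambda>w. w \<in> D) (at z)"
      using assms(2) z by (rule eventually_at_in_open')
    ultimately have ev: "eventually (\<lambda>w. Finite (g w) = f w) (at z)"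
      by eventually_elim (simp add: f)
    have "((\<lambda>w. Finite (g w)) \<longlongrightarrow> f z) (at z)"
    proof (cases "is_pole g z")
      case True
      thus ?thesis using tendsto_Infinity f[OF z] by (simp add: is_pole_def)
    next
      case False
      hence "g \<midarrow>z\<rightarrow> g z" using g z by (auto simp: nicely_meromorphic_on_def)
      thus ?thesis using tendsto_Finite f[OF z] False by simp
    qed
    thus ?thesis using ev by (rule Lim_transform_eventually)
  qed
  thus ?thesis by (simp add: continuous_on_eq_continuous_at[OF assms(2)] isCont_def)
qed

end

theory Submission
  imports Defs
begin

text \<open>
  Send \<open>a\<close>, \<open>b\<close>, \<open>c\<close> to \<open>0\<close>, \<open>\<infinity>\<close>, \<open>1\<close> by the cross-ratio. For each \<open>f\<close> in the family
  the composition \<open>g\<close> of \<open>f\<close> with the cross-ratio is then a holomorphic function that omits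
  \<open>0\<close> and \<open>1\<close>, and so does \<open>1 / g\<close>, which is the cross-ratio with \<open>a\<close> and \<open>b\<close> exchanged. Fix a
  point \<open>w\<close>. One of \<open>g\<close> and \<open>1 / g\<close> has modulus at most \<open>1\<close> at \<open>w\<close>, and Schottky's theorem (in
  the form \<open>GPicard1\<close>) bounds that one near \<open>w\<close> by a constant that does not depend on \<open>f\<close>.
  Cauchy's estimate turns the bound into a Lipschitz estimate at \<open>w\<close>.

  The estimate is carried back to \<open>f\<close> by the Plucker relation. Let \<open>p \<and> q\<close> be the determinant of
  homogeneous coordinates of \<open>p\<close> and \<open>q\<close>. Up to a constant factor, the difference of the
  cross-ratios of \<open>p\<close> and \<open>q\<close> is \<open>(p \<and> q) / ((p \<and> b) (q \<and> b))\<close>, while the chordal distance of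
  \<open>p\<close> and \<open>q\<close> is \<open>2 |p \<and> q| / (|p| |q|)\<close>. As \<open>|p \<and> b| \<le> |p| |b|\<close>, the chordal distance is at
  most a constant times the difference of the cross-ratios, uniformly on the whole sphere minus
  \<open>b\<close> (lemma \<open>dist_ecomplex_small_cross_ratio\<close>). Hence the family is
  equicontinuous at each point of \<open>D\<close>
  (lemma \<open>omitting_three_values_equicontinuous_at\<close>), with no distinction between finite and
  infinite limits.

  Finally the sphere is compact, so the Arzela--Ascoli argument extracts a locally uniformly
  convergent subsequence (lemma \<open>equicontinuous_imp_locally_uniform_subsequence\<close>).
\<close>

section \<open>Homogeneous coordinates and the chordal distance\<close>

fun hom_coords :: "ecomplex \<Rightarrow> complex \<times> complex" where
  "hom_coords (Finite z) = (z, 1)"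
| "hom_coords Infinity = (1, 0)"

definition wedge :: "ecomplex \<Rightarrow> ecomplex \<Rightarrow> complex" where
  "wedge p q = fst (hom_coords p) * snd (hom_coords q) - snd (hom_coords p) * fst (hom_coords q)"

lemma wedge_eq_0_iff: "wedge p q = 0 \<longleftrightarrow> p = q"
  by (cases p; cases q) (auto simp: wedge_def)

text \<open>
  The three-term Plucker relation for vectors in the plane; it makes differences of cross-ratios
  factorise.
\<close>

lemma wedge_Plucker: "wedge p a * wedge q b - wedge q a * wedge p b = wedge p q * wedge a b"
  by (simp add: wedge_def algebra_simps)

lemma norm_hom_coords_ge_1: "1 \<le> norm (hom_coords p)"
  by (cases p) (auto simp: norm_prod_def)

text \<open>
  The area of a parallelogram is at most the product of its sides; here it follows from the
  Cauchy--Schwarz inequality for the vectors of moduli.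
\<close>

lemma norm_wedge_le: "cmod (wedge p q) \<le> norm (hom_coords p) * norm (hom_coords q)"
proof -
  obtain x y where p: "hom_coords p = (x, y)" by force
  obtain u v where q: "hom_coords q = (u, v)" by force
  have "cmod (wedge p q) \<le> cmod x * cmod v + cmod y * cmod u"
    unfolding wedge_def p q using norm_triangle_ineq4[of "x * v" "y * u"] by (simp add: norm_mult)
  also have "\<dots> = (cmod x, cmod y) \<bullet> (cmod v, cmod u)" by simp
  also have "\<dots> \<le> norm (cmod x, cmod y) * norm (cmod v, cmod u)" by (rule norm_cauchy_schwarz)
  also have "\<dots> = norm (hom_coords p) * norm (hom_coords q)"
    by (simp add: p q norm_prod_def add.commute)
  finally show ?thesis .
qed

text \<open>
  For unit vectors \<open>u\<close> and \<open>v\<close>, \<open>2 (1 - u \<bullet> v)\<close> is the square of \<open>|u - v|\<close>. So this is the classical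
  formula \<open>2 |z - w| / sqrt ((1 + |z|\<^sup>2) (1 + |w|\<^sup>2))\<close> for the chordal distance, written
  homogeneously so that it covers the point at infinity.
\<close>

lemma inner_stereo_eq_wedge:
  "1 - stereo p \<bullet> stereo q
     = 2 * (cmod (wedge p q) / (norm (hom_coords p) * norm (hom_coords q)))\<^sup>2"
proof (cases p; cases q)
  fix z w assume pq: "p = Finite z" "q = Finite w"
  define s t where "s = (cmod z)\<^sup>2" and "t = (cmod w)\<^sup>2"
  have pos: "s + 1 > 0" "t + 1 > 0" by (simp_all add: s_def t_def add_nonneg_pos)
  have "(cmod (z - w))\<^sup>2 = s + t - 2 * (z \<bullet> w)"
    by (simp add: s_def t_def power2_norm_eq_inner inner_diff inner_commute)
  moreover have "(norm (hom_coords p))\<^sup>2 = s + 1" "(norm (hom_coords q))\<^sup>2 = t + 1"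
    by (simp_all add: pq norm_prod_def s_def t_def)
  ultimately have "2 * (cmod (wedge p q) / (norm (hom_coords p) * norm (hom_coords q)))\<^sup>2
      = 2 * (s + t - 2 * (z \<bullet> w)) / ((s + 1) * (t + 1))"
    by (simp add: pq wedge_def power_divide power_mult_distrib)
  also have "\<dots> = 1 - (4 * (z \<bullet> w) + (s - 1) * (t - 1)) / ((s + 1) * (t + 1))"
    using pos by (simp add: divide_simps) (simp add: algebra_simps)
  also have "(4 * (z \<bullet> w) + (s - 1) * (t - 1)) / ((s + 1) * (t + 1)) = stereo p \<bullet> stereo q"
    unfolding pq stereo.simps s_def[symmetric] t_def[symmetric] inner_Pair
    by (simp add: add_divide_distrib)
  finally show ?thesis ..
next
  fix z assume pq: "p = Finite z" "q = Infinity"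
  have pos: "(cmod z)\<^sup>2 + 1 > 0" by (simp add: add_nonneg_pos)
  moreover have "(norm (hom_coords p))\<^sup>2 = (cmod z)\<^sup>2 + 1" by (simp add: pq norm_prod_def)
  ultimately show ?thesis
    by (simp add: pq wedge_def power_divide power_mult_distrib norm_prod_def field_simps)
next
  fix z assume pq: "p = Infinity" "q = Finite z"
  have pos: "(cmod z)\<^sup>2 + 1 > 0" by (simp add: add_nonneg_pos)
  moreover have "(norm (hom_coords q))\<^sup>2 = (cmod z)\<^sup>2 + 1" by (simp add: pq norm_prod_def)
  ultimately show ?thesis
    by (simp add: pq wedge_def power_divide power_mult_distrib norm_prod_def field_simps)
next
  assume pq: "p = Infinity" "q = Infinity"
  thus ?thesis by (simp add: wedge_def)
qed

text \<open>
  The spherical distance is a continuous function of the chordal distance that vanishes at \<open>0\<close>, so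
  a small chordal distance forces a small spherical distance, uniformly on the sphere.
\<close>

lemma dist_ecomplex_small:
  assumes "e > 0"
  obtains d where "d > 0"
    "\<And>p q. cmod (wedge p q) < d * (norm (hom_coords p) * norm (hom_coords q)) \<Longrightarrow> dist p q < e"
proof -
  have "continuous_on {-1..1} (\<lambda>t::real. arccos (1 - 2 * t\<^sup>2))"
    by (intro continuous_intros)  (auto simp: abs_square_le_1 abs_le_iff)
  then obtain d where d: "d > 0"
    "\<And>t. t \<in> {-1..1} \<Longrightarrow> dist t 0 < d \<Longrightarrow> dist (arccos (1 - 2 * t\<^sup>2)) (arccos (1 - 2 * 0\<^sup>2)) < e"
    unfolding continuous_on_iff using assms by (metis atLeastAtMost_iff le_minus_one_simps(1) zero_le_one)
  show thesis
  proof
    fix p q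
    define N where "N = norm (hom_coords p) * norm (hom_coords q)"
    assume less: "cmod (wedge p q) < d * (norm (hom_coords p) * norm (hom_coords q))"
    have N: "N > 0" unfolding N_def
      using norm_hom_coords_ge_1[of p] norm_hom_coords_ge_1[of q] by (intro mult_pos_pos) linarith+
    define t where "t = cmod (wedge p q) / N"
    have "0 \<le> t" "t \<le> 1" "t < d"
      using N less norm_wedge_le[of p q] by (auto simp: t_def N_def[symmetric] field_simps)
    hence "dist (arccos (1 - 2 * t\<^sup>2)) (arccos (1 - 2 * 0\<^sup>2)) < e" by (intro d) auto
    moreover have "dist p q = arccos (1 - 2 * t\<^sup>2)"
      using arg_cong[OF inner_stereo_eq_wedge[of p q], of "\<lambda>x. arccos (1 - x)"]
      by (simp add: dist_ecomplex_def t_def N_def)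
    ultimately show "dist p q < e" by simp
  qed (rule d)
qed

section \<open>Compactness of the sphere\<close>

text \<open>
  The preimage of \<open>(x, t)\<close> is the point where the line from the north pole through \<open>(x, t)\<close> meets
  the plane, that is \<open>x / (1 - t)\<close>.
\<close>

lemma stereo_surj:
  assumes "norm v = 1"
  obtains p where "stereo p = v"
proof -
  obtain x t where v: "v = (x, t)" by force
  have sq: "(cmod x)\<^sup>2 + t\<^sup>2 = 1" using assms by (simp add: v norm_prod_def)
  show thesis
  proof (cases "t = 1")
    case True
    thus ?thesis using sq that[of Infinity] v by simp
  next
    case False
    have "t\<^sup>2 \<le> 1" using sq by (metis le_add_same_cancel2 zero_le_power2)
    hence "t < 1" using False by (simp add: abs_square_le_1)
    have "(cmod (x /\<^sub>R (1 - t)))\<^sup>2 = (1 - t\<^sup>2) / (1 - t)\<^sup>2"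
      using sq by (simp add: power_mult_distrib power_inverse divide_inverse)
    also have "\<dots> = (1 + t) / (1 - t)"
      using \<open>t < 1\<close> by (simp add: divide_simps) (simp add: power2_eq_square algebra_simps)
    finally have n: "(cmod (x /\<^sub>R (1 - t)))\<^sup>2 = (1 + t) / (1 - t)" .
    have "(1 + t) / (1 - t) + 1 = 2 / (1 - t)" "(1 + t) / (1 - t) - 1 = 2 * t / (1 - t)"
      using \<open>t < 1\<close> by (simp_all add: field_simps)
    moreover have "2 / (2 / (1 - t)) = 1 - t" "2 * t / (1 - t) / (2 / (1 - t)) = t"
      using \<open>t < 1\<close> by simp_all
    ultimately have "stereo (Finite (x /\<^sub>R (1 - t))) = ((1 - t) *\<^sub>R (x /\<^sub>R (1 - t)), t)"
      unfolding stereo.simps n by (simp only:)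
    also have "\<dots> = v" using \<open>t < 1\<close> by (simp add: v)
    finally show ?thesis using that by blast
  qed
qed

lemma compact_UNIV_ecomplex: "compact (UNIV :: ecomplex set)"
  unfolding compact_eq_seq_compact_metric seq_compact_def
proof (intro allI impI)
  fix s :: "nat \<Rightarrow> ecomplex"
  have "\<forall>n. (stereo \<circ> s) n \<in> sphere 0 1" by simp
  then obtain l r where l: "l \<in> sphere 0 1" "strict_mono r" "((stereo \<circ> s) \<circ> r) \<longlonglongrightarrow> l"
    using compact_sphere[of "0 :: complex \<times> real" 1]
    unfolding compact_eq_seq_compact_metric seq_compact_def by blast
  obtain p where "stereo p = l" using l(1) by (auto intro: stereo_surj)
  hence "(s \<circ> r) \<longlonglongrightarrow> p" using l(3) by (simp add: tendsto_ecomplex_iff o_def)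
  thus "\<exists>l\<in>UNIV. \<exists>r. strict_mono r \<and> (s \<circ> r) \<longlonglongrightarrow> l" using l(2) by blast
qed

section \<open>Equicontinuity and locally uniform convergence\<close>

text \<open>
  The Arzela--Ascoli theorem on an open set, for maps into a compact metric space that need not be
  a vector space. Compactness of the codomain and a diagonal argument give a subsequence that
  converges on a countable dense set. By equicontinuity it is Cauchy, hence convergent, at every
  point of \<open>D\<close>, and covering a compact set by finitely many balls of equicontinuity makes the
  convergence uniform there.
\<close>

lemma equicontinuous_imp_locally_uniform_subsequence:
  fixes s :: "nat \<Rightarrow> 'a::euclidean_space \<Rightarrow> 'b::metric_space"
  assumes "open D" and compact: "compact (UNIV :: 'b set)"
    and equi: "\<And>w e. w \<in> D \<Longrightarrow> e > 0 \<Longrightarrow>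
      \<exists>d>0. \<forall>n. \<forall>z\<in>D. dist z w < d \<longrightarrow> dist (s n z) (s n w) < e"
  obtains r h where "strict_mono r" "locally_uniform_limit_on D (s \<circ> r) h"
proof (cases "D = {}")
  case True
  thus ?thesis using that[of id] by (simp add: locally_uniform_limit_on_def strict_mono_id)
next
  case False
  obtain R where R: "countable R" "R \<subseteq> D" "D \<subseteq> closure R" by (metis separable)
  with False have "R \<noteq> {}" by auto
  with R(1) obtain \<sigma> :: "nat \<Rightarrow> 'a" where \<sigma>: "R = range \<sigma>" using uncountable_def by blast
  obtain r :: "nat \<Rightarrow> nat" where r: "strict_mono r" "\<And>i. convergent (\<lambda>n. s ((id \<circ> r) n) (\<sigma> i))"
  proof (rule subsequence_diagonalization_lemma
      [of "\<lambda>i r. convergent (\<lambda>n. s (r n) (\<sigma> i))" id])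
    fix i and q :: "nat \<Rightarrow> nat"
    show "\<exists>k. strict_mono k \<and> convergent (\<lambda>n. s ((q \<circ> k) n) (\<sigma> i))"
      using compact unfolding compact_eq_seq_compact_metric seq_compact_def convergent_def
      by (force simp: o_def dest: spec[of _ "\<lambda>n. s (q n) (\<sigma> i)"])
  next
    fix i N and q k1 k2 :: "nat \<Rightarrow> nat"
    assume "convergent (\<lambda>n. s ((q \<circ> k1) n) (\<sigma> i))"
      and "\<And>j. N \<le> j \<Longrightarrow> \<exists>j'\<ge>j. k2 j = k1 j'"
    thus "convergent (\<lambda>n. s ((q \<circ> k2) n) (\<sigma> i))"
      unfolding convergent_def lim_sequentially o_def by (metis le_cases order_trans)
  qed auto
  define u where "u = s \<circ> r"
  have conv_R: "convergent (\<lambda>n. u n x)" if "x \<in> R" for x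
    using that r(2) by (auto simp: \<sigma> u_def o_def)
  have conv: "convergent (\<lambda>n. u n w)" if w: "w \<in> D" for w
  proof -
    have "Cauchy (\<lambda>n. u n w)"
      unfolding Cauchy_def
    proof (intro allI impI)
      fix e :: real assume "e > 0"
      then obtain d where d: "d > 0" "\<And>n z. z \<in> D \<Longrightarrow> dist z w < d \<Longrightarrow> dist (s n z) (s n w) < e/3"
        using equi[OF w, of "e/3"] by auto
      obtain x where x: "x \<in> R" "dist x w < d"
        using R(3) w d(1) by (meson closure_approachable subsetD)
      have "Cauchy (\<lambda>n. u n x)" using conv_R[OF x(1)] by (rule convergent_Cauchy)
      then obtain M where M: "\<And>m n. m \<ge> M \<Longrightarrow> n \<ge> M \<Longrightarrow> dist (u m x) (u n x) < e/3"
        using \<open>e > 0\<close> unfolding Cauchy_def by (metis divide_pos_pos zero_less_numeral)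
      have near: "dist (u n x) (u n w) < e/3" for n
        using d(2) x R(2) by (auto simp: u_def)
      show "\<exists>M. \<forall>m\<ge>M. \<forall>n\<ge>M. dist (u m w) (u n w) < e"
        using M near by (meson dist_commute_lessI dist_triangle_third)
    qed
    thus ?thesis using compact_imp_complete[OF compact]
      by (auto simp: complete_def convergent_def)
  qed
  define h where "h w = lim (\<lambda>n. u n w)" for w
  have lim: "(\<lambda>n. u n w) \<longlonglongrightarrow> h w" if "w \<in> D" for w
    using conv[OF that] by (simp add: h_def convergent_LIMSEQ_iff)
  have uniform: "uniform_limit K u h sequentially" if K: "compact K" "K \<subseteq> D" for K
    unfolding uniform_limit_sequentially_iff
  proof (intro allI impI)
    fix e :: real assume "e > 0"
    hence "\<forall>w\<in>D. \<exists>d>0. \<forall>n. \<forall>z\<in>D. dist z w < d \<longrightarrow> dist (s n z) (s n w) < e/4"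
      using equi[where e = "e/4"] by simp
    then obtain d where d: "\<And>w. w \<in> D \<Longrightarrow> d w > 0"
      "\<And>w n z. w \<in> D \<Longrightarrow> z \<in> D \<Longrightarrow> dist z w < d w \<Longrightarrow> dist (s n z) (s n w) < e/4"
      by metis
    obtain T where T: "T \<subseteq> K" "finite T" "K \<subseteq> (\<Union>w\<in>T. ball w (d w))"
    proof (rule compactE_image[OF K(1), of K "\<lambda>w. ball w (d w)"])
      show "K \<subseteq> (\<Union>w\<in>K. ball w (d w))" using d(1) K(2) by force
    qed auto
    have "\<forall>\<^sub>F n in sequentially. \<forall>t\<in>T. dist (u n t) (h t) < e/4"
      using T(1,2) K(2) lim \<open>e > 0\<close> by (intro eventually_ball_finite ballI tendstoD) auto
    then obtain N where N: "\<And>n t. n \<ge> N \<Longrightarrow> t \<in> T \<Longrightarrow> dist (u n t) (h t) < e/4"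
      by (auto simp: eventually_sequentially)
    show "\<exists>N. \<forall>n\<ge>N. \<forall>x\<in>K. dist (u n x) (h x) < e"
    proof (intro exI allI impI ballI)
      fix n x assume n: "n \<ge> N" and x: "x \<in> K"
      obtain t where t: "t \<in> T" "dist x t < d t" using T(3) x by (auto simp: dist_commute)
      have xt: "x \<in> D" "t \<in> D" using x t T(1) K(2) by auto
      have near: "dist (u m x) (u m t) < e/4" for m
        using d(2)[OF xt(2,1) t(2)] by (simp add: u_def)
      have "dist (h x) (h t) \<le> e/4"
        using near by (intro Lim_bounded[OF tendsto_dist[OF lim lim]] xt) (auto intro: less_imp_le)
      thus "dist (u n x) (h x) < e"
        using near[of n] N[OF n t(1)] dist_triangle[of "u n x" "h x" "u n t"]
          dist_triangle[of "u n t" "h x" "h t"] \<open>e > 0\<close> by (simp add: dist_commute)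
    qed
  qed
  have "locally_uniform_limit_on D u h"
    unfolding locally_uniform_limit_on_def
  proof
    fix w assume "w \<in> D"
    then obtain e where e: "e > 0" "cball w e \<subseteq> D" using assms(1) open_contains_cball by blast
    have "uniform_limit (ball w e) u h sequentially"
      using uniform[OF compact_cball e(2)] ball_subset_cball by (rule uniform_limit_on_subset)
    moreover have "openin (top_of_set D) (ball w e)"
      using e(2) ball_subset_cball by (intro open_subset) auto
    ultimately show "\<exists>U. openin (top_of_set D) U \<and> w \<in> U \<and> uniform_limit U u h sequentially"
      using e(1) by (meson centre_in_ball)
  qed
  thus ?thesis using that r(1) by (simp add: u_def)
qed

section \<open>The cross-ratio\<close>

text \<open>
  The Moebius map that sends \<open>a\<close>, \<open>b\<close>, \<open>c\<close> to \<open>0\<close>, \<open>\<infinity>\<close>, \<open>1\<close>. At \<open>b\<close> the division by zero returns the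
  default value \<open>0\<close> in place of \<open>\<infinity>\<close>.
\<close>

definition cross_ratio :: "ecomplex \<Rightarrow> ecomplex \<Rightarrow> ecomplex \<Rightarrow> ecomplex \<Rightarrow> complex" where
  "cross_ratio a b c p = wedge p a * wedge c b / (wedge p b * wedge c a)"

lemma cross_ratio_swap: "cross_ratio b a c p = inverse (cross_ratio a b c p)"
  by (simp add: cross_ratio_def)

lemma cross_ratio_neq_0:
  assumes "distinct [a, b, c]" "p \<notin> {a, b}"
  shows "cross_ratio a b c p \<noteq> 0"
  using assms by (auto simp: cross_ratio_def wedge_eq_0_iff)

lemma cross_ratio_neq_1:
  assumes "distinct [a, b, c]" "p \<notin> {b, c}"
  shows "cross_ratio a b c p \<noteq> 1"
proof
  assume "cross_ratio a b c p = 1"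
  hence "wedge p a * wedge c b = wedge p b * wedge c a"
    using assms by (auto simp: cross_ratio_def wedge_eq_0_iff)
  hence "wedge p c * wedge a b = 0" using wedge_Plucker[of p a c b] by (simp add: mult.commute)
  thus False using assms by (auto simp: wedge_eq_0_iff)
qed

text \<open>
  Over the common denominator, the numerator of the difference of two cross-ratios is one side of
  the Plucker relation.
\<close>

lemma wedge_eq_cross_ratio_diff:
  assumes "distinct [a, b, c]" "p \<noteq> b" "q \<noteq> b"
  shows "wedge p q = (cross_ratio a b c p - cross_ratio a b c q) *
           (wedge c a / (wedge c b * wedge a b)) * wedge p b * wedge q b"
proof -
  have nz: "wedge c a \<noteq> 0" "wedge c b \<noteq> 0" "wedge a b \<noteq> 0" "wedge p b \<noteq> 0" "wedge q b \<noteq> 0"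
    using assms by (auto simp: wedge_eq_0_iff)
  hence "(cross_ratio a b c p - cross_ratio a b c q) *
           (wedge c a / (wedge c b * wedge a b)) * wedge p b * wedge q b
         = (wedge p a * wedge q b - wedge q a * wedge p b) / wedge a b"
    by (simp add: cross_ratio_def divide_simps) (simp add: algebra_simps)
  thus ?thesis using nz by (simp add: wedge_Plucker)
qed

text \<open>
  The inverse of the Moebius map is uniformly continuous from the plane, with its Euclidean metric,
  to the sphere. The factors \<open>p \<and> b\<close> and \<open>q \<and> b\<close> in the previous lemma are absorbed by the norms of
  \<open>p\<close> and \<open>q\<close> in the chordal distance.
\<close>

lemma dist_ecomplex_small_cross_ratio:
  assumes "distinct [a, b, c]" "e > 0"
  obtains d where "d > 0" "\<And>p q. p \<noteq> b \<Longrightarrow> q \<noteq> b \<Longrightarrow>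
    cmod (cross_ratio a b c p - cross_ratio a b c q) < d \<Longrightarrow> dist p q < e"
proof -
  obtain d where d: "d > 0"
    "\<And>p q. cmod (wedge p q) < d * (norm (hom_coords p) * norm (hom_coords q)) \<Longrightarrow> dist p q < e"
    using dist_ecomplex_small[OF assms(2)] by metis
  define K where "K = cmod (wedge c a / (wedge c b * wedge a b)) * (norm (hom_coords b))\<^sup>2"
  have K: "K > 0" 
    using assms(1) norm_hom_coords_ge_1[of b] unfolding K_def
    by (intro mult_pos_pos) (auto simp: wedge_eq_0_iff)
  show thesis
  proof
    show "d / K > 0" using d(1) K by simp
    fix p q
    assume pq: "p \<noteq> b" "q \<noteq> b" 
      and less: "cmod (cross_ratio a b c p - cross_ratio a b c q) < d / K" (is "?\<delta> < _")
    have pos: "norm (hom_coords p) * norm (hom_coords q) > 0"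
      using norm_hom_coords_ge_1[of p] norm_hom_coords_ge_1[of q] by (intro mult_pos_pos) linarith+
    have "cmod (wedge p q) = ?\<delta> * cmod (wedge c a / (wedge c b * wedge a b)) *
        (cmod (wedge p b) * cmod (wedge q b))"
      by (subst wedge_eq_cross_ratio_diff[OF assms(1) pq]) (simp add: norm_mult norm_divide)
    also have "\<dots> \<le> ?\<delta> * cmod (wedge c a / (wedge c b * wedge a b)) *
        ((norm (hom_coords p) * norm (hom_coords b)) * (norm (hom_coords q) * norm (hom_coords b)))"
      by (intro mult_left_mono mult_mono norm_wedge_le) auto
    also have "\<dots> = ?\<delta> * K * (norm (hom_coords p) * norm (hom_coords q))"
      by (simp add: K_def power2_eq_square)
    also have "\<dots> < d * (norm (hom_coords p) * norm (hom_coords q))"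
      using less K pos by (intro mult_strict_right_mono) (simp_all add: field_simps)
    finally show "dist p q < e" by (rule d(2))
  qed
qed

text \<open>
  The cross-ratio is homogeneous of degree \<open>0\<close> in the coordinates of its argument, so it suffices to
  represent \<open>f\<close> near each point by analytic homogeneous coordinates without a common zero: \<open>(g, 1)\<close>
  where \<open>g\<close> is finite, and \<open>(1, 1 / g)\<close> at a pole.
\<close>

lemma cross_ratio_holomorphic_on:
  assumes "open D" "sphere_meromorphic_on f D" "\<And>z. z \<in> D \<Longrightarrow> f z \<noteq> b" "c \<noteq> a"
  shows "(\<lambda>z. cross_ratio a b c (f z)) holomorphic_on D"
proof -
  obtain g where g: "g nicely_meromorphic_on D"
    and f: "\<And>z. z \<in> D \<Longrightarrow> f z = (if is_pole g z then Infinity else Finite (g z))"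
    using assms(2) unfolding sphere_meromorphic_on_def by blast
  \<comment> \<open>The scalar \<open>t\<close> may depend on \<open>w\<close> in any way, since it cancels in the cross-ratio.\<close>
  have lift: "(\<lambda>z. cross_ratio a b c (f z)) analytic_on {z}"
    if z: "z \<in> D" and X: "X analytic_on {z}" and Y: "Y analytic_on {z}"
      and ev: "\<forall>\<^sub>F w in nhds z. \<exists>t. t \<noteq> 0 \<and> hom_coords (f w) = (t * X w, t * Y w)" for z X Y
  proof -
    define W where "W q w = X w * snd (hom_coords q) - Y w * fst (hom_coords q)" for q w
    have W: "W q analytic_on {z}" for q
      unfolding W_def by (intro analytic_intros X Y)
    have eq: "\<exists>t. t \<noteq> 0 \<and> (\<forall>q. wedge (f w) q = t * W q w)"
      if "\<exists>t. t \<noteq> 0 \<and> hom_coords (f w) = (t * X w, t * Y w)" for w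
      using that by (auto simp: wedge_def W_def algebra_simps)
    have "W b z \<noteq> 0"
      using eq[OF eventually_nhds_x_imp_x[OF ev]] assms(3)[OF z] by (metis mult_zero_right wedge_eq_0_iff)
    hence "(\<lambda>w. W a w * wedge c b / (W b w * wedge c a)) analytic_on {z}"
      using assms(4) by (intro analytic_intros W) (auto simp: wedge_eq_0_iff)
    moreover have "\<forall>\<^sub>F w in nhds z. W a w * wedge c b / (W b w * wedge c a) = cross_ratio a b c (f w)"
      using ev
    proof eventually_elim
      case (elim w)
      then obtain t where "t \<noteq> 0" "\<And>q. wedge (f w) q = t * W q w" using eq by blast
      thus ?case by (simp add: cross_ratio_def)
    qed
    ultimately show ?thesis
      using analytic_at_cong[OF _ refl, of "\<lambda>w. W a w * wedge c b / (W b w * wedge c a)"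
          "\<lambda>w. cross_ratio a b c (f w)" z] by blast
  qed
  have "(\<lambda>z. cross_ratio a b c (f z)) analytic_on {z}" if z: "z \<in> D" for z
  proof (cases "is_pole g z")
    case False
    have ana: "g analytic_on {z}"
      using nicely_meromorphic_on_imp_analytic_at[OF g z False] .
    then obtain S where S: "open S" "z \<in> S" "g holomorphic_on S"
      by (auto simp: analytic_at)
    have "\<forall>\<^sub>F w in nhds z. w \<in> S \<inter> D"
      using assms(1) z S by (intro eventually_nhds_in_open) auto
    hence "\<forall>\<^sub>F w in nhds z. \<exists>t. t \<noteq> 0 \<and> hom_coords (f w) = (t * g w, t * 1)"
    proof eventually_elim
      case (elim w)
      hence "\<not> is_pole g w" using not_is_pole_holomorphic S by blast
      thus ?case using f[of w] elim by (intro exI[of _ 1]) simp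
    qed
    thus ?thesis by (intro lift[OF z ana, of "\<lambda>_. 1"]) auto
  next
    case True
    have gz: "g nicely_meromorphic_on {z}" using g z by (auto intro: nicely_meromorphic_on_subset)
    \<comment> \<open>The dummy value of \<open>g\<close> at its pole makes \<open>inverse (g z) = 0\<close>, which is the correct second
      coordinate of \<open>Infinity\<close>.\<close>
    have "g z = 0" using is_pole_zero_at_nicely_mero[OF g True z] .
    have "(\<lambda>w. inverse (g w)) \<midarrow>z\<rightarrow> 0"
      using True filterlim_compose[OF tendsto_inverse_0] by (simp add: is_pole_def)
    hence "\<not> is_pole (\<lambda>w. inverse (g w)) z"
      by (metis at_neq_bot is_pole_def not_tendsto_and_filterlim_at_infinity)
    hence ana: "(\<lambda>w. inverse (g w)) analytic_on {z}"
      by (intro nicely_meromorphic_on_imp_analytic_at[OF nicely_meromorphic_on_inverse[OF gz]]) auto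
    have "g meromorphic_on {z}" using gz by (simp add: nicely_meromorphic_on_def)
    hence "\<forall>\<^sub>F w in at z. \<not> is_pole g w" using eventually_not_pole meromorphic_at_iff by blast
    moreover have "\<forall>\<^sub>F w in at z. g w \<noteq> 0" using True by (rule non_zero_neighbour_pole)
    moreover have "\<forall>\<^sub>F w in at z. w \<in> D" using assms(1) z by (rule eventually_at_in_open')
    ultimately have "\<forall>\<^sub>F w in at z. \<exists>t. t \<noteq> 0 \<and> hom_coords (f w) = (t * 1, t * inverse (g w))"
      by eventually_elim (auto simp: f)
    moreover have "\<exists>t. t \<noteq> 0 \<and> hom_coords (f z) = (t * 1, t * inverse (g z))"
      using f[OF z] True \<open>g z = 0\<close> by (intro exI[of _ 1]) simp
    ultimately have "\<forall>\<^sub>F w in nhds z. \<exists>t. t \<noteq> 0 \<and> hom_coords (f w) = (t * 1, t * inverse (g w))"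
      by (simp add: eventually_nhds_conv_at)
    thus ?thesis by (intro lift[OF z _ ana, of "\<lambda>_. 1"]) auto
  qed
  thus ?thesis by (meson analytic_imp_holomorphic analytic_on_analytic_at)
qed

section \<open>Functions omitting three values\<close>

text \<open>
  Discs of radius \<open>e / 4\<close> around the points of \<open>ball w (e / 2)\<close> stay in \<open>ball w e\<close>, so Cauchy's
  estimate bounds the derivative by \<open>B / (e / 4)\<close> there.
\<close>

lemma bounded_holomorphic_imp_Lipschitz_at_centre:
  assumes "h holomorphic_on ball w e" "e > 0" "\<And>z. z \<in> ball w e \<Longrightarrow> cmod (h z) \<le> B"
    and "z \<in> ball w (e / 2)"
  shows "cmod (h z - h w) \<le> 4 * B / e * dist z w"
proof -
  have "cmod (h z - h w) \<le> 4 * B / e * cmod (z - w)"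
  proof (rule field_differentiable_bound[OF convex_ball])
    fix x assume "x \<in> ball w (e / 2)"
    hence sub: "cball x (e / 4) \<subseteq> ball w e" using assms(2) by (subst cball_subset_ball_iff) (auto simp: dist_commute)
    show "(h has_field_derivative deriv h x) (at x within ball w (e / 2))"
      using \<open>x \<in> ball w (e / 2)\<close> assms(2)
      by (intro holomorphic_derivI[OF assms(1) open_ball, THEN has_field_derivative_at_within]) auto
    have "cmod ((deriv ^^ 1) h x) \<le> fact 1 * B / (e / 4) ^ 1"
      using assms(2) sub
      by (intro Cauchy_inequality assms(3) holomorphic_on_subset[OF assms(1)]
          holomorphic_on_imp_continuous_on) (auto simp: dist_norm subset_eq)
    thus "cmod (deriv h x) \<le> 4 * B / e" by (simp add: mult.commute)
  qed (use assms in auto)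
  thus ?thesis by (simp add: dist_norm)
qed

text \<open>
  Schottky's theorem: a holomorphic function that omits \<open>0\<close> and \<open>1\<close> is bounded near \<open>w\<close> in terms of
  its modulus at \<open>w\<close> and the distance from \<open>w\<close> to the boundary only. This is what gives one \<open>B\<close> and one \<open>e\<close> for the whole family.
\<close>

lemma cross_ratio_bounded_near:
  assumes "open D" "connected D" "w \<in> D" "distinct [a, b, c]" 
    and F: "\<And>f. f \<in> F \<Longrightarrow> sphere_meromorphic_on f D \<and> f ` D \<inter> {a, b, c} = {}"
  obtains B e where "B > 0" "e > 0" "ball w e \<subseteq> D"
    "\<And>f z. f \<in> F \<Longrightarrow> cmod (cross_ratio a b c (f w)) \<le> 1 \<Longrightarrow> z \<in> ball w e \<Longrightarrow>
        cmod (cross_ratio a b c (f z)) \<le> B"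
proof -
  define X where "X = (\<lambda>f z. cross_ratio a b c (f z)) ` F"
  have hol: "h holomorphic_on D" if "h \<in> X" for h
    using that assms(4) F unfolding X_def
    by (fastforce intro!: cross_ratio_holomorphic_on[OF assms(1)])
  have omit: "h z \<noteq> 0 \<and> h z \<noteq> 1" if "h \<in> X" "z \<in> D" for h z
    using that F cross_ratio_neq_0[OF assms(4)] cross_ratio_neq_1[OF assms(4)]
    unfolding X_def by fastforce
  obtain B Z where B: "B > 0" "open Z" "w \<in> Z" "Z \<subseteq> D"
    "\<And>h z. h \<in> {h \<in> X. cmod (h w) \<le> 1} \<Longrightarrow> z \<in> Z \<Longrightarrow> cmod (h z) \<le> B"
    by (rule GPicard1[OF assms(1-3) zero_less_one, of "{h \<in> X. cmod (h w) \<le> 1}" X])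
       (use hol omit in auto)
  obtain e where e: "e > 0" "ball w e \<subseteq> Z" using B(2,3) open_contains_ball by blast
  show thesis
  proof
    show "cmod (cross_ratio a b c (f z)) \<le> B"
      if "f \<in> F" "cmod (cross_ratio a b c (f w)) \<le> 1" "z \<in> ball w e" for f z
      using B(5)[of "\<lambda>z. cross_ratio a b c (f z)" z] that e(2) by (auto simp: X_def)
  qed (use e B(1,4) in auto)
qed

lemma equicontinuous_at_if_cross_ratio_le_1:
  assumes "open D" "connected D" "w \<in> D" "distinct [a, b, c]" "\<epsilon> > 0"
    and F: "\<And>f. f \<in> F \<Longrightarrow> sphere_meromorphic_on f D \<and> f ` D \<inter> {a, b, c} = {}"
  shows "\<exists>d>0. \<forall>f\<in>F. cmod (cross_ratio a b c (f w)) \<le> 1 \<longrightarrow>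
           (\<forall>z\<in>D. dist z w < d \<longrightarrow> dist (f z) (f w) < \<epsilon>)"
proof -
  obtain B e where B: "B > 0" "e > 0" "ball w e \<subseteq> D"
    "\<And>f z. f \<in> F \<Longrightarrow> cmod (cross_ratio a b c (f w)) \<le> 1 \<Longrightarrow> z \<in> ball w e \<Longrightarrow>
        cmod (cross_ratio a b c (f z)) \<le> B"
    using cross_ratio_bounded_near[OF assms(1-4) F] by metis
  obtain \<delta> where \<delta>: "\<delta> > 0" "\<And>p q. p \<noteq> b \<Longrightarrow> q \<noteq> b \<Longrightarrow>
    cmod (cross_ratio a b c p - cross_ratio a b c q) < \<delta> \<Longrightarrow> dist p q < \<epsilon>"
    using dist_ecomplex_small_cross_ratio[OF assms(4,5)] by metis
  define d where "d = min (e / 2) (\<delta> * e / (4 * B))"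
  have "d > 0" using B(1,2) \<delta>(1) by (simp add: d_def)
  moreover have "dist (f z) (f w) < \<epsilon>"
    if f: "f \<in> F" "cmod (cross_ratio a b c (f w)) \<le> 1" and z: "z \<in> D" "dist z w < d" for f z
  proof (rule \<delta>(2))
    have "(\<lambda>z. cross_ratio a b c (f z)) holomorphic_on ball w e"
      using assms(4) F[OF f(1)]
      by (intro holomorphic_on_subset[OF cross_ratio_holomorphic_on[OF assms(1)] B(3)]) auto
    hence "cmod (cross_ratio a b c (f z) - cross_ratio a b c (f w)) \<le> 4 * B / e * dist z w"
      using B(2,4) f z(2)
      by (intro bounded_holomorphic_imp_Lipschitz_at_centre[where h = "\<lambda>z. cross_ratio a b c (f z)"])
         (auto simp: d_def dist_commute)
    also have "\<dots> < 4 * B / e * (\<delta> * e / (4 * B))"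
      using z(2) B(1,2) by (intro mult_strict_left_mono) (auto simp: d_def)
    also have "\<dots> = \<delta>" using B(1,2) by simp
    finally show "cmod (cross_ratio a b c (f z) - cross_ratio a b c (f w)) < \<delta>" .
  qed (use assms(3) F[OF f(1)] z(1) in auto)
  ultimately show ?thesis by blast
qed

text \<open>
  The members whose cross-ratio is large at \<open>w\<close> are handled by exchanging \<open>a\<close> and \<open>b\<close>, which inverts
  the cross-ratio; so every member falls under one of two uniform estimates.
\<close>

lemma omitting_three_values_equicontinuous_at:
  assumes "open D" "connected D" "w \<in> D" "distinct [a, b, c]" "\<epsilon> > 0"
    and F: "\<And>f. f \<in> F \<Longrightarrow> sphere_meromorphic_on f D \<and> f ` D \<inter> {a, b, c} = {}"
  shows "\<exists>d>0. \<forall>f\<in>F. \<forall>z\<in>D. dist z w < d \<longrightarrow> dist (f z) (f w) < \<epsilon>"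
proof -
  have dist': "distinct [b, a, c]" using assms(4) by auto
  have F': "sphere_meromorphic_on f D \<and> f ` D \<inter> {b, a, c} = {}" if "f \<in> F" for f
    using F[OF that] by (simp only: insert_commute)
  obtain d1 where d1: "d1 > 0"
    "\<And>f z. f \<in> F \<Longrightarrow> cmod (cross_ratio a b c (f w)) \<le> 1 \<Longrightarrow> z \<in> D \<Longrightarrow> dist z w < d1 \<Longrightarrow>
       dist (f z) (f w) < \<epsilon>"
    using equicontinuous_at_if_cross_ratio_le_1[OF assms] by metis
  obtain d2 where d2: "d2 > 0"
    "\<And>f z. f \<in> F \<Longrightarrow> cmod (cross_ratio b a c (f w)) \<le> 1 \<Longrightarrow> z \<in> D \<Longrightarrow> dist z w < d2 \<Longrightarrow>
       dist (f z) (f w) < \<epsilon>"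
    using equicontinuous_at_if_cross_ratio_le_1[OF assms(1-3) dist' assms(5) F'] by metis
  have "cmod (cross_ratio a b c p) \<le> 1 \<or> cmod (cross_ratio b a c p) \<le> 1" for p
    by (auto simp: cross_ratio_swap[of b] norm_inverse inverse_le_1_iff)
  hence "\<forall>f\<in>F. \<forall>z\<in>D. dist z w < min d1 d2 \<longrightarrow> dist (f z) (f w) < \<epsilon>"
    using d1(2) d2(2) by (metis min_less_iff_conj)
  thus ?thesis using d1(1) d2(1) by (metis min_less_iff_conj)
qed

theorem theorem5p4:
  fixes D :: "complex set" and F :: "(complex \<Rightarrow> ecomplex) set" and a b c :: ecomplex
  assumes "open D" and "connected D" and "D \<noteq> {}"
    and "a \<noteq> b" and "b \<noteq> c" and "a \<noteq> c"
    and "\<And>f. f \<in> F \<Longrightarrow> sphere_meromorphic_on f D"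
    and "\<And>f z. f \<in> F \<Longrightarrow> z \<in> D \<Longrightarrow> f z \<notin> {a, b, c}"
  shows "normal_family_on F D"
  unfolding normal_family_on_def
proof (intro allI impI)
  fix s :: "nat \<Rightarrow> complex \<Rightarrow> ecomplex"
  assume s: "range s \<subseteq> F"
  have abc: "distinct [a, b, c]" using assms(4-6) by simp
  have "\<exists>d>0. \<forall>n. \<forall>z\<in>D. dist z w < d \<longrightarrow> dist (s n z) (s n w) < \<epsilon>"
    if "w \<in> D" "\<epsilon> > 0" for w \<epsilon>
  proof -
    obtain d where d: "d > 0" "\<forall>f\<in>F. \<forall>z\<in>D. dist z w < d \<longrightarrow> dist (f z) (f w) < \<epsilon>"
      using omitting_three_values_equicontinuous_at
          [OF assms(1,2) \<open>w \<in> D\<close> abc \<open>\<epsilon> > 0\<close>, of F] assms(7,8) by blast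
    have "s n \<in> F" for n using s by auto
    thus ?thesis using d by blast
  qed
  from equicontinuous_imp_locally_uniform_subsequence[OF assms(1) compact_UNIV_ecomplex this]
  show "\<exists>r h. strict_mono r \<and> locally_uniform_limit_on D (s \<circ> r) h" by metis
qed

end
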